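(* Let $n\in\mathbb{N}\cup\{0\}$, $\tau\in(0,+\infty)$, $d\in\mathbb{N}$, and let $f:[0,(n+1)\tau]\times\mathbb{R}^d\times\mathbb{R}^d\to\mathbb{R}^d$ and $\varphi:[-\tau,0]\to\mathbb{R}^d$ satisfy the following assumptions: (A1) $f(t,\cdot,\cdot)\in C(\mathbb{R}^d\times\mathbb{R}^d;\mathbb{R}^d)$ for all $t\in[0,(n+1)\tau]$, and $\varphi\in C([-\tau,0];\mathbb{R}^d)$; (A2) $f(\cdot,x,z)$ is Borel measurable for all $(x,z)\in\mathbb{R}^d\times\mathbb{R}^d$; (A3) there exists $K\in(0,\infty)$ such that for all $t\in[0,(n+1)\tau]$ and $x,z\in\mathbb{R}^d$, $|f(t,x,z)|\le K(1+|x|)(1+|z|)$; (A4) there exists $L\in(0,\infty)$ such that for all $t\in[0,(n+1)\tau]$ and $x_1,x_2,z\in\mathbb{R}^d$, $|f(t,x_1,z)-f(t,x_2,z)|\le L(1+|z|)|x_1-x_2|$. Then there exists a unique absolutely continuous solution $x$ of the delay differential equation $$x'(t)=f(t,x(t),x(t-\tau)),\ t\in[0,(n+1)\tau],\qquad x(t)=\varphi(t),\ t\in[-\tau,0].$$ Moreover, writing $\phi_j(t)=x(t+j\tau)$ for $t\in[0,\tau]$ and $j=0,1,\ldots,n$, and defining $K_{-1}:=\max_{t\in[-\tau,0]}|\varphi(t)|$ and, for $j=0,1,\ldots,n$, $$K_j=(1+K_{j-1})(1+K\tau)\exp\bigl((1+K_{j-1})K\tau\bigr),$$ where $K$ is the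 constant in (A3), we have for all $j=0,1,\ldots,n$ $$\sup_{0\le t\le\tau}|\phi_j(t)|\le K_j,$$ and for all $j=0,1,\ldots,n$ and all $t,s\in[0,\tau]$ $$|\phi_j(t)-\phi_j(s)|\le(1+K_{j-1})(1+K_j)K|t-s|.$$
   Context: $|\cdot|$ denotes the Euclidean norm in $\mathbb{R}^d$. Solutions are understood in the Carathéodory sense: $x:[-\tau,(n+1)\tau]\to\mathbb{R}^d$ equals $\varphi$ on $[-\tau,0]$, is absolutely continuous on $[0,(n+1)\tau]$, and satisfies the differential equation for almost every $t\in[0,(n+1)\tau]$. Equivalently, with $\phi_{-1}(t):=\varphi(t-\tau)$ for $t\in[0,\tau]$, the functions $\phi_0,\ldots,\phi_n$ are absolutely continuous on $[0,\tau]$ and satisfy $\phi_j'(t)=f(t+j\tau,\phi_j(t),\phi_{j-1}(t))$ for almost every $t\in[0,\tau]$, with $\phi_j(0)=\phi_{j-1}(\tau)$, for $j=0,1,\ldots,n$. *)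

theory Defs
  imports "HOL-Analysis.Analysis"
begin

text \<open>
  Absolute continuity of a function on a real interval \<open>S\<close>, in the usual epsilon-delta form. A finite
  family of non-overlapping subintervals is given by the set of its pairs of endpoints.
  (The library constant \<open>absolutely_continuous\<close> is about measures.)
\<close>

definition absolutely_continuous_on :: "real set \<Rightarrow> (real \<Rightarrow> 'a::real_normed_vector) \<Rightarrow> bool" where
  "absolutely_continuous_on S g \<longleftrightarrow>
     (\<forall>\<epsilon>>0. \<exists>\<delta>>0. \<forall>D. finite D \<longrightarrow>
        (\<forall>(u, v)\<in>D. u < v \<and> {u..v} \<subseteq> S) \<longrightarrow>
        disjoint_family_on (\<lambda>(u, v). {u<..<v}) D \<longrightarrow>
        (\<Sum>(u, v)\<in>D. v - u) < \<delta> \<longrightarrow>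
        (\<Sum>(u, v)\<in>D. norm (g v - g u)) < \<epsilon>)"

text \<open>
  Caratheodory solutions \<open>x\<close> on \<open>{- \<tau>..T}\<close> of \<open>x'(t) = f(t, x(t), x(t - \<tau>))\<close> with initial function
  \<open>\<phi>\<close>. The predicate depends only on the values of \<open>x\<close> on \<open>{- \<tau>..T}\<close>.
\<close>

definition dde_solution ::
  "(real \<Rightarrow> 'a \<Rightarrow> 'a \<Rightarrow> 'a) \<Rightarrow> (real \<Rightarrow> 'a) \<Rightarrow> real \<Rightarrow> real \<Rightarrow> (real \<Rightarrow> 'a::real_normed_vector) \<Rightarrow> bool" where
  "dde_solution f \<phi> \<tau> T x \<longleftrightarrow>
     (\<forall>t\<in>{- \<tau>..0}. x t = \<phi> t) \<and>
     absolutely_continuous_on {0..T} x \<and>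
     (AE t\<in>{0..T} in lebesgue.
        (x has_vector_derivative f t (x t) (x (t - \<tau>))) (at t within {0..T}))"

text \<open>
  The constants \<open>K\<^sub>j\<close> for \<open>j = -1, 0, 1, \<dots>\<close>, with the index shifted by one: \<open>growth_const K \<tau> \<phi> 0\<close> is
  \<open>K\<^sub>-\<^sub>1\<close> and \<open>growth_const K \<tau> \<phi> (Suc j)\<close> is \<open>K\<^sub>j\<close>. The supremum is a maximum for continuous \<open>\<phi>\<close>.
\<close>

primrec growth_const :: "real \<Rightarrow> real \<Rightarrow> (real \<Rightarrow> 'a::real_normed_vector) \<Rightarrow> nat \<Rightarrow> real" where
  "growth_const K \<tau> \<phi> 0 = (SUP t\<in>{- \<tau>..0}. norm (\<phi> t))"
| "growth_const K \<tau> \<phi> (Suc j) =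
     (1 + growth_const K \<tau> \<phi> j) * (1 + K * \<tau>) * exp ((1 + growth_const K \<tau> \<phi> j) * K * \<tau>)"

end

theory Submission
  imports Defs
begin

text \<open>
  The equation is solved by the method of steps: on \<open>{j * \<tau>..(j + 1) * \<tau>}\<close> the delayed argument is a
  known continuous function, so that the equation is an ordinary Caratheodory equation, Lipschitz
  in the state, to which Picard iteration applies. Gronwall's inequality gives uniqueness and the
  bounds \<open>K\<^sub>j\<close>, and integrating the growth bound gives the Lipschitz estimates.

  Caratheodory solutions are the continuous solutions of the integral equation. In one direction,
  absolute continuity controls the part of a Riemann sum whose tags lie in the exceptional null
  set (Henstock--Kurzweil integral); in the other, Henstock's lemma and Vitali's covering theorem
  show that an indefinite integral is differentiable almost everywhere.
\<close>

section \<open>Absolute continuity and the fundamental theorem of calculus\<close>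

text \<open>The right-hand side is Lipschitz in the state but only continuous in the delayed
  argument, so two candidate solutions can be compared on a step only once their delayed values are
  known to agree. The factor 1 + |z| in A4 also becomes a constant only on a single step, where z
  runs over a compact set. The integral equation carries the induction because adjoining a step is
  then just additivity of the integral, whereas gluing absolutely continuous pieces would need its
  own argument. The Henstock--Kurzweil integral asks for no measurability of a derivative when the
  equation is integrated. The constants come from A3: where the delayed value is at most K_{j-1},
  the right-hand side is at most B (1 + |x|) with B = (1 + K_{j-1}) K. Gronwall on a step of length
  \<tau> gives (K_{j-1} + B \<tau>) exp (B \<tau>), and K_{j-1} + B \<tau> \<le> (1 + K_{j-1}) (1 +
  K \<tau>).\<close>

lemma sum_length_disjoint_intervals_le:
  fixes D :: "(real \<times> real) set"
  assumes "finite D" and sub: "\<And>u v. (u, v) \<in> D \<Longrightarrow> u \<le> v \<and> {u<..<v} \<subseteq> U"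
    and disj: "disjoint_family_on (\<lambda>(u, v). {u<..<v}) D"
    and U: "U \<in> lmeasurable"
  shows "(\<Sum>(u, v)\<in>D. v - u) \<le> measure lebesgue U"
proof -
  have "(\<Sum>(u, v)\<in>D. v - u) = (\<Sum>p\<in>D. measure lebesgue ((\<lambda>(u, v). {u<..<v}) p))"
    using sub by (intro sum.cong) auto
  also have "\<dots> = measure lebesgue (\<Union>p\<in>D. (\<lambda>(u, v). {u<..<v}) p)"
  proof (intro measure_finite_Union [symmetric] \<open>finite D\<close> disj)
    show "emeasure lebesgue (case p of (u, v) \<Rightarrow> {u<..<v}) \<noteq> \<infinity>" if "p \<in> D" for p
      using that sub by (cases p) auto
  qed auto
  also have "\<dots> \<le> measure lebesgue U"
    using sub \<open>finite D\<close> by (intro measure_mono_fmeasurable U sets.finite_UN) auto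
  finally show ?thesis .
qed

lemma absolutely_continuous_on_subset:
  assumes "absolutely_continuous_on S g" "T \<subseteq> S"
  shows "absolutely_continuous_on T g"
  unfolding absolutely_continuous_on_def
proof (intro allI impI)
  fix e :: real assume "e > 0"
  then obtain d where "d > 0" and d: "\<And>D. \<lbrakk>finite D; \<forall>(u, v)\<in>D. u < v \<and> {u..v} \<subseteq> S;
     disjoint_family_on (\<lambda>(u, v). {u<..<v}) D; (\<Sum>(u, v)\<in>D. v - u) < d\<rbrakk>
     \<Longrightarrow> (\<Sum>(u, v)\<in>D. norm (g v - g u)) < e"
    using assms(1) unfolding absolutely_continuous_on_def by meson
  show "\<exists>\<delta>>0. \<forall>D. finite D \<longrightarrow>
        (\<forall>(u, v)\<in>D. u < v \<and> {u..v} \<subseteq> T) \<longrightarrow>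
        disjoint_family_on (\<lambda>(u, v). {u<..<v}) D \<longrightarrow>
        (\<Sum>(u, v)\<in>D. v - u) < \<delta> \<longrightarrow> (\<Sum>(u, v)\<in>D. norm (g v - g u)) < e"
  proof (intro exI conjI allI impI)
    fix D assume D: "finite D" "\<forall>(u, v)\<in>D. u < v \<and> {u..v} \<subseteq> T"
        "disjoint_family_on (\<lambda>(u, v). {u<..<v}) D" "(\<Sum>(u, v)\<in>D. v - u) < d"
    then have "\<forall>(u, v)\<in>D. u < v \<and> {u..v} \<subseteq> S" using assms(2) by fast
    then show "(\<Sum>(u, v)\<in>D. norm (g v - g u)) < e" using d D by blast
  qed (use \<open>d > 0\<close> in auto)
qed

lemma Lipschitz_imp_absolutely_continuous_on:
  assumes "\<And>u v. \<lbrakk>u \<in> S; v \<in> S\<rbrakk> \<Longrightarrow> norm (g v - g u) \<le> C * \<bar>v - u\<bar>"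
  shows "absolutely_continuous_on S g"
  unfolding absolutely_continuous_on_def
proof (intro allI impI)
  fix e :: real assume "e > 0"
  show "\<exists>\<delta>>0. \<forall>D. finite D \<longrightarrow>
        (\<forall>(u, v)\<in>D. u < v \<and> {u..v} \<subseteq> S) \<longrightarrow>
        disjoint_family_on (\<lambda>(u, v). {u<..<v}) D \<longrightarrow>
        (\<Sum>(u, v)\<in>D. v - u) < \<delta> \<longrightarrow> (\<Sum>(u, v)\<in>D. norm (g v - g u)) < e"
  proof (intro exI conjI allI impI)
    \<comment> \<open>Replacing \<open>C\<close> by |C| + 1 gives a positive Lipschitz constant
      whatever the sign of \<open>C\<close>.\<close>
    show "e / (\<bar>C\<bar> + 1) > 0" using \<open>e > 0\<close> by simp
    fix D assume D: "\<forall>(u, v)\<in>D. u < v \<and> {u..v} \<subseteq> S" "(\<Sum>(u, v)\<in>D. v - u) < e / (\<bar>C\<bar> + 1)"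
    have "(\<Sum>(u, v)\<in>D. norm (g v - g u)) \<le> (\<Sum>p\<in>D. (\<bar>C\<bar> + 1) * (case p of (u, v) \<Rightarrow> v - u))"
    proof (intro sum_mono, clarify)
      fix u v assume "(u, v) \<in> D"
      then have uv: "u < v" "u \<in> S" "v \<in> S" using D(1) by fastforce+
      then have "norm (g v - g u) \<le> C * (v - u)" using assms[of u v] by simp
      also have "\<dots> \<le> (\<bar>C\<bar> + 1) * (v - u)" using uv by (intro mult_right_mono) auto
      finally show "norm (g v - g u) \<le> (\<bar>C\<bar> + 1) * (v - u)" .
    qed
    also have "\<dots> = (\<bar>C\<bar> + 1) * (\<Sum>(u, v)\<in>D. v - u)" by (simp add: sum_distrib_left)
    also have "\<dots> < e" using D(2) by (simp add: field_simps)
    finally show "(\<Sum>(u, v)\<in>D. norm (g v - g u)) < e" .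
  qed
qed

text \<open>In a fine Riemann sum, a piece tagged outside \<open>N\<close> differs from the
  increment of \<open>g\<close> by a small multiple of its length. With the integrand set to 0 on
  \<open>N\<close>, a piece tagged in \<open>N\<close> leaves exactly the increment of
  \<open>g\<close>; the gauge confines these pieces to an open set of small measure, where absolute
  continuity makes the increments sum to little.\<close>

theorem fundamental_theorem_of_calculus_absolutely_continuous:
  fixes g :: "real \<Rightarrow> 'a::banach"
  assumes "a \<le> b" and AC: "absolutely_continuous_on {a..b} g" and N: "negligible N"
    and der: "\<And>x. x \<in> {a..b} - N \<Longrightarrow> (g has_vector_derivative h x) (at x within {a..b})"
  shows "(h has_integral (g b - g a)) {a..b}"
proof (rule has_integral_spike [OF N])
  let ?h = "\<lambda>x. if x \<in> N then 0 else h x"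
  show "h x = ?h x" if "x \<in> {a..b} - N" for x using that by simp
  show "(?h has_integral (g b - g a)) {a..b}"
    unfolding has_integral_real
  proof (intro allI impI)
    fix e :: real assume "e > 0"
    \<comment> \<open>The summand 1 keeps the denominator positive when
      \<open>a = b\<close>.\<close>
    define e1 where "e1 = e / (2 * (b - a + 1))"
    have "e1 > 0" and e1: "e1 * (b - a) < e / 2"
      using \<open>e > 0\<close> \<open>a \<le> b\<close> by (auto simp: e1_def field_simps)
    have "e / 2 > 0" using \<open>e > 0\<close> by simp
    then obtain d where "d > 0" and d: "\<And>D. \<lbrakk>finite D; \<forall>(u, v)\<in>D. u < v \<and> {u..v} \<subseteq> {a..b};
       disjoint_family_on (\<lambda>(u, v). {u<..<v}) D; (\<Sum>(u, v)\<in>D. v - u) < d\<rbrakk>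
       \<Longrightarrow> (\<Sum>(u, v)\<in>D. norm (g v - g u)) < e / 2"
      using AC unfolding absolutely_continuous_on_def by meson
    \<comment> \<open>Outer regularity puts the null set into an open set of measure below the
      \<open>d\<close> of absolute continuity.\<close>
    obtain U where U: "open U" "N \<subseteq> U" "U \<in> lmeasurable" "measure lebesgue U < d"
    proof -
      have "N \<in> sets lebesgue" using N by (rule negligible_imp_sets)
      then obtain T where T: "open T" "N \<subseteq> T" "T - N \<in> lmeasurable" "emeasure lebesgue (T - N) < ennreal d"
        using sets_lebesgue_outer_open \<open>d > 0\<close> by blast
      have eq: "T = (T - N) \<union> N" using T(2) by blast
      have "T \<in> lmeasurable"
        by (subst eq) (intro fmeasurable.Un T negligible_imp_measurable N)
      moreover have "measure lebesgue T = measure lebesgue (T - N)"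
        by (rule measure_negligible_symdiff [OF T(3)]) (use N in \<open>auto intro: negligible_subset\<close>)
      moreover have "measure lebesgue (T - N) < d"
        using T(3,4) \<open>d > 0\<close> by (simp add: emeasure_eq_measure2 ennreal_less_iff)
      ultimately show ?thesis using that T by metis
    qed
    have "\<forall>x. \<exists>r>0. x \<in> {a..b} - N \<longrightarrow>
         (\<forall>y\<in>{a..b}. norm (y-x) < r \<longrightarrow> norm (g y - g x - (y-x) *\<^sub>R h x) \<le> e1 * norm (y-x))"
    proof
      fix x
      show "\<exists>r>0. x \<in> {a..b} - N \<longrightarrow>
         (\<forall>y\<in>{a..b}. norm (y-x) < r \<longrightarrow> norm (g y - g x - (y-x) *\<^sub>R h x) \<le> e1 * norm (y-x))"
      proof (cases "x \<in> {a..b} - N")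
        case True
        then show ?thesis
          using der[OF True, unfolded has_vector_derivative_def has_derivative_within_alt] \<open>e1 > 0\<close>
          by blast
      qed (use zero_less_one in blast)
    qed
    then obtain r where r: "\<And>x. 0 < r x"
      "\<And>x y. \<lbrakk>x \<in> {a..b} - N; y \<in> {a..b}; norm (y-x) < r x\<rbrakk>
                        \<Longrightarrow> norm (g y - g x - (y-x) *\<^sub>R h x) \<le> e1 * norm (y-x)"
      by metis
    let ?\<gamma> = "\<lambda>x. if x \<in> N then U else ball x (r x)"
    have gauge: "gauge ?\<gamma>" using r(1) U by (auto simp: gauge_def)
    have bnd: "norm (sum (\<lambda>(x,k). measure lborel k *\<^sub>R ?h x) p - (g b - g a)) < e"
      if p: "p tagged_division_of {a..b}" and fine: "?\<gamma> fine p" for p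
    proof -
      note pD = tagged_division_ofD [OF p]
      have ba: "b - a = (\<Sum>(x,K)\<in>p. Sup K - Inf K)" "g b - g a = (\<Sum>(x,K)\<in>p. g (Sup K) - g (Inf K))"
        using additive_tagged_division_1[where f= "\<lambda>x. x"] additive_tagged_division_1[where f= g]
            \<open>a \<le> b\<close> p by auto
      have Keq: "K = {Inf K..Sup K} \<and> Inf K \<le> Sup K" if "(x, K) \<in> p" for x K
      proof -
        obtain u v where "K = cbox u v" "x \<in> K" using pD(2,4) \<open>(x, K) \<in> p\<close> by blast
        then show ?thesis by auto
      qed
      have Kin: "{Inf K..Sup K} \<subseteq> {a..b} \<and> Inf K \<in> ?\<gamma> x \<and> Sup K \<in> ?\<gamma> x \<and> {Inf K..Sup K} \<subseteq> ?\<gamma> x \<and> Inf K \<le> x \<and> x \<le> Sup K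
          \<and> Inf K \<in> {a..b} \<and> Sup K \<in> {a..b}"
        if "(x, K) \<in> p" for x K
      proof -
        define G where "G = ?\<gamma> x"
        have "K \<subseteq> {a..b}" "K \<subseteq> G" "x \<in> K"
          unfolding G_def by (rule pD(3)[OF that], rule fineD[OF fine that], rule pD(2)[OF that])
        moreover have "Inf K \<in> K" "Sup K \<in> K" using Keq[OF that] by (metis atLeastAtMost_iff order_refl)+
        moreover have "{Inf K..Sup K} = K" using Keq[OF that] by simp
        moreover have "Inf K \<le> x" "x \<le> Sup K" using calculation by auto
        ultimately show ?thesis unfolding G_def [symmetric] by blast
      qed
      \<comment> \<open>Degenerate pieces are left out because absolute continuity speaks of
        intervals with \<open>u < v\<close>; their increments vanish anyway. Nondegeneracy also
        makes \<open>f\<close>, which forgets the tag, injective: pieces with disjoint interiors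
        cannot then have the same endpoints.\<close>
      define pN where "pN = {(x, K). (x, K) \<in> p \<and> x \<in> N \<and> Inf K < Sup K}"
      have finpN: "finite pN" by (rule finite_subset[OF _ pD(1)]) (auto simp: pN_def)
      have disj: "{Inf K<..<Sup K} \<inter> {Inf K'<..<Sup K'} = {}" if "(x, K) \<in> p" "(x', K') \<in> p" "(x, K) \<noteq> (x', K')" for x K x' K'
        using pD(5)[OF that] Keq[OF that(1)] Keq[OF that(2)] interior_atLeastAtMost_real by metis
      define f where "f = (\<lambda>(x::real, K::real set). (Inf K, Sup K))"
      have inj: "inj_on f pN"
      proof (rule inj_onI, clarify)
        fix x K x' K'
        assume *: "(x, K) \<in> pN" "(x', K') \<in> pN" "f (x, K) = f (x', K')"
        have "Inf K < Sup K" using * by (auto simp: pN_def)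
        then have "{Inf K<..<Sup K} \<inter> {Inf K'<..<Sup K'} \<noteq> {}" using * by (auto simp: f_def)
        then show "x = x' \<and> K = K'" using disj[of x K x' K'] * by (auto simp: pN_def)
      qed
      have dD: "disjoint_family_on (\<lambda>(u, v). {u<..<v}) (f ` pN)"
        unfolding disjoint_family_on_def
      proof (intro ballI impI)
        fix m m' assume *: "m \<in> f ` pN" "m' \<in> f ` pN" "m \<noteq> m'"
        then obtain x K x' K' where **: "(x, K) \<in> pN" "(x', K') \<in> pN" "m = f (x, K)" "m' = f (x', K')" by auto
        then have "(x, K) \<noteq> (x', K')" using \<open>m \<noteq> m'\<close> by blast
        moreover have "(x, K) \<in> p" "(x', K') \<in> p" using ** by (auto simp: pN_def)
        ultimately show "(case m of (u, v) \<Rightarrow> {u<..<v}) \<inter> (case m' of (u, v) \<Rightarrow> {u<..<v}) = {}"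
          using disj[of x K x' K'] by (simp add: ** f_def)
      qed
      have "(\<Sum>(u, v)\<in>f ` pN. v - u) \<le> measure lebesgue U"
      proof (rule sum_length_disjoint_intervals_le [OF _ _ dD U(3)])
        fix u v assume "(u, v) \<in> f ` pN"
        then obtain x K where *: "(x, K) \<in> p" "x \<in> N" "u = Inf K" "v = Sup K" "u < v" by (auto simp: f_def pN_def)
        then have "{u..v} \<subseteq> U" using Kin[of x K] by auto
        then show "u \<le> v \<and> {u<..<v} \<subseteq> U" using * by force
      qed (use finpN in auto)
      then have "(\<Sum>(u, v)\<in>f ` pN. norm (g v - g u)) < e / 2"
        using U(4) finpN dD Kin by (intro d) (auto simp: f_def pN_def)
      then have sN: "(\<Sum>(x,K)\<in>pN. norm (g (Sup K) - g (Inf K))) < e / 2"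
        by (subst (asm) sum.reindex [OF inj]) (simp add: f_def case_prod_unfold)
      have "norm (sum (\<lambda>(x,k). measure lborel k *\<^sub>R ?h x) p - (g b - g a))
         = norm (\<Sum>(x,K)\<in>p. measure lborel K *\<^sub>R ?h x - (g (Sup K) - g (Inf K)))"
        unfolding ba(2) by (simp add: sum_subtractf case_prod_unfold)
      also have "\<dots> \<le> (\<Sum>(x,K)\<in>p. e1 * (Sup K - Inf K) + (if (x, K) \<in> pN then norm (g (Sup K) - g (Inf K)) else 0))"
      proof (rule sum_norm_le, clarify)
        fix x K assume xK: "(x, K) \<in> p"
        define u v where "u = Inf K" "v = Sup K"
        have uv: "u \<le> v" "u \<le> x" "x \<le> v" "u \<in> {a..b}" "v \<in> {a..b}" "u \<in> ?\<gamma> x" "v \<in> ?\<gamma> x" "x \<in> {a..b}"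
          using Kin[OF xK] by (auto simp: u_v_def)
        have cont: "measure lborel K = v - u" using Keq[OF xK] uv(1) unfolding u_v_def by (metis content_real)
        show "norm (measure lborel K *\<^sub>R ?h x - (g (Sup K) - g (Inf K)))
           \<le> e1 * (Sup K - Inf K) + (if (x, K) \<in> pN then norm (g (Sup K) - g (Inf K)) else 0)"
        proof (cases "x \<in> N")
          case True
          then show ?thesis using xK uv(1) \<open>e1 > 0\<close>
            by (cases "u = v") (auto simp: cont pN_def norm_minus_commute simp flip: u_v_def)
        next
          case False
          \<comment> \<open>Both endpoints are compared with the tag. As it lies between them, the
            errors e1 (x - u) and e1 (v - x) add up to e1 (v - u).\<close>
          have "norm ((v - u) *\<^sub>R h x - (g v - g u)) =
             norm ((g u - g x - (u - x) *\<^sub>R h x) - (g v - g x - (v - x) *\<^sub>R h x))"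
            by (auto simp: algebra_simps)
          also have "\<dots> \<le> norm (g u - g x - (u - x) *\<^sub>R h x) + norm (g v - g x - (v - x) *\<^sub>R h x)"
            by (rule norm_triangle_ineq4)
          also have "\<dots> \<le> e1 * norm (u - x) + e1 * norm (v - x)"
            using uv False by (intro add_mono r(2)) (auto simp: dist_real_def)
          also have "\<dots> = e1 * (v - u)" using uv by (simp add: algebra_simps)
          finally show ?thesis using False by (simp add: cont pN_def flip: u_v_def)
        qed
      qed
      also have "\<dots> = e1 * (b - a) + (\<Sum>(x,K)\<in>p. if (x, K) \<in> pN then norm (g (Sup K) - g (Inf K)) else 0)"
        unfolding ba(1) by (simp add: sum.distrib sum_distrib_left case_prod_unfold)
      also have "(\<Sum>(x,K)\<in>p. if (x, K) \<in> pN then norm (g (Sup K) - g (Inf K)) else 0)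
          = (\<Sum>(x,K)\<in>pN. norm (g (Sup K) - g (Inf K)))"
        using pD(1) by (intro sum.mono_neutral_cong_right) (auto simp: pN_def split: if_splits)
      also have "e1 * (b - a) + \<dots> < e" using sN e1 by simp
      finally show ?thesis .
    qed
    show "\<exists>\<gamma>. gauge \<gamma> \<and> (\<forall>p. p tagged_division_of {a..b} \<and> \<gamma> fine p \<longrightarrow>
        norm (sum (\<lambda>(x,k). measure lborel k *\<^sub>R ?h x) p - (g b - g a)) < e)"
      by (intro exI conjI allI impI) (rule gauge, elim conjE, rule bnd)
  qed
qed

section \<open>Differentiation of indefinite integrals\<close>

text \<open>Translates between the balls of the Vitali covering theorem and the intervals of tagged
  divisions; the tag \<open>x\<close> may be either endpoint.\<close>

lemma cball_midpoint_eq_atLeastAtMost: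
  fixes x y :: real
  shows "cball ((x + y) / 2) (\<bar>y - x\<bar> / 2) = {min x y..max x y}"
  by (auto simp: cball_eq_atLeastAtMost min_def max_def field_simps abs_if split: if_splits)

text \<open>Where differentiability fails, arbitrarily short intervals at \<open>x\<close> have a
  Henstock error of at least a fixed multiple \<open>c\<close> of their length. Vitali selects
  disjoint ones that cover almost all such points. Finitely many of them form a fine partial
  division, so Henstock's lemma bounds their total length.\<close>

theorem indefinite_integral_has_vector_derivative_ae:
  fixes h :: "real \<Rightarrow> 'a::euclidean_space"
  assumes h: "h integrable_on {a..b}"
  shows "negligible {x \<in> {a..b}.
    \<not> ((\<lambda>u. integral {a..u} h) has_vector_derivative h x) (at x within {a..b})}"
proof -
  define F where "F = (\<lambda>u. integral {a..u} h)"
  define R where "R = (\<lambda>x y. F y - F x - (y - x) *\<^sub>R h x)"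
  define E where "E = (\<lambda>c. {x \<in> {a..b}. \<forall>d>0. \<exists>y\<in>{a..b}. \<bar>y - x\<bar> < d \<and> c * \<bar>y - x\<bar> < norm (R x y)})"
  have F_diff: "integral {x..y} h = F y - F x" if "a \<le> x" "x \<le> y" "y \<le> b" for x y
  proof -
    have "h integrable_on {a..y}" by (rule integrable_subinterval_real [OF h]) (use that in auto)
    from Henstock_Kurzweil_Integration.integral_combine [OF that(1,2) this]
    show ?thesis unfolding F_def by (simp add: algebra_simps)
  qed
  have neg: "negligible (E c)" if "c > 0" for c
    unfolding negligible_outer_le
  proof (intro allI impI)
    fix e :: real assume "e > 0"
    \<comment> \<open>The Henstock tolerance is \<open>c * e\<close>, since passing from errors to
      lengths divides by \<open>c\<close>.\<close>
    have ce: "c * e > 0" using \<open>c > 0\<close> \<open>e > 0\<close> by simp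
    have hc: "h integrable_on cbox a b" using h by simp
    obtain \<gamma> where "gauge \<gamma>"
      and \<gamma>: "\<And>p. \<lbrakk>p tagged_partial_division_of (cbox a b); \<gamma> fine p\<rbrakk> \<Longrightarrow>
             sum (\<lambda>(x,k). norm (measure lborel k *\<^sub>R h x - integral k h)) p < c * e"
      by (rule Henstock_lemma [OF hc ce]) (rule that)
    define m r where "m = (\<lambda>(x::real, y). (x + y) / 2)" and "r = (\<lambda>(x::real, y). \<bar>y - x\<bar> / 2)"
    have cb: "cball (m (x, y)) (r (x, y)) = {min x y..max x y}" for x y
      by (simp add: m_def r_def cball_midpoint_eq_atLeastAtMost)
    \<comment> \<open>A bad point \<open>x\<close> is covered by the intervals with endpoints \<open>x\<close> and \<open>y\<close>, tagged at \<open>x\<close>; each has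
      length at most \<open>1/c\<close> times its Henstock error.\<close>
    define I where "I = {(x, y). x \<in> {a..b} \<and> y \<in> {a..b} \<and> {min x y..max x y} \<subseteq> \<gamma> x
        \<and> c * \<bar>y - x\<bar> < norm (R x y)}"
    have neq: "x \<noteq> y" if "(x, y) \<in> I" for x y
      using that by (auto simp: I_def R_def)
    obtain C where C: "countable C" "C \<subseteq> I"
      and disj: "pairwise (\<lambda>i j. disjnt (cball (m i) (r i)) (cball (m j) (r j))) C"
      and neg: "negligible (E c - (\<Union>i \<in> C. cball (m i) (r i)))"
    proof (rule Vitali_covering_theorem_cballs [of I r "E c" m])
      show "0 < r i" if "i \<in> I" for i
        using neq that by (cases i) (auto simp: r_def)
      show "\<exists>i. i \<in> I \<and> x \<in> cball (m i) (r i) \<and> r i < d" if x: "x \<in> E c" and "0 < d" for x d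
      proof -
        have "open (\<gamma> x)" "x \<in> \<gamma> x" using \<open>gauge \<gamma>\<close> by (auto simp: gauge_def)
        then obtain d' where "d' > 0" and d': "ball x d' \<subseteq> \<gamma> x" using open_contains_ball by blast
        obtain y where y: "y \<in> {a..b}" "\<bar>y - x\<bar> < min d d'" "c * \<bar>y - x\<bar> < norm (R x y)"
          using x \<open>0 < d\<close> \<open>d' > 0\<close> unfolding E_def by (smt (verit) mem_Collect_eq)
        have "{min x y..max x y} \<subseteq> ball x d'"
          using y(2) by (auto simp: dist_real_def)
        then have "(x, y) \<in> I" using x y d' by (auto simp: I_def E_def)
        moreover have "x \<in> cball (m (x, y)) (r (x, y))" unfolding cb by simp
        moreover have "r (x, y) < d" using y(2) \<open>0 < d\<close> by (simp add: r_def)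
        ultimately show ?thesis by blast
      qed
    qed
    let ?T = "\<Union>i \<in> C. cball (m i) (r i)"
    \<comment> \<open>Henstock's lemma concerns finite families; a bound uniform over finite
      subfamilies carries over to the countable union \<open>?T\<close>.\<close>
    have bound: "measure lebesgue (\<Union>i\<in>I'. cball (m i) (r i)) \<le> e" if I': "I' \<subseteq> C" "finite I'" for I'
    proof -
      define k where "k = (\<lambda>(x, y). (x::real, {min x y..max x y}))"
      have disj': "cball (m i) (r i) \<inter> cball (m j) (r j) = {}" if "i \<in> I'" "j \<in> I'" "i \<noteq> j" for i j
        using disj that I' by (auto simp: pairwise_def disjnt_def)
      have snd_k: "snd (k i) = cball (m i) (r i)" for i
        by (cases i) (simp only: k_def cb split_conv snd_conv)
      have nonempty: "cball (m i) (r i) \<noteq> {}" for i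
        by (cases i) (simp only: cb, simp)
      have inj: "inj_on k I'"
      proof (rule inj_onI, rule ccontr)
        fix i j assume "i \<in> I'" "j \<in> I'" "k i = k j" "i \<noteq> j"
        then show False using disj'[of i j] nonempty[of i] snd_k[of i] snd_k[of j] by auto
      qed
      have p: "k ` I' tagged_partial_division_of cbox a b"
        unfolding tagged_partial_division_of_def
      proof (intro conjI allI impI)
        show "finite (k ` I')" using I' by simp
      next
        fix x K assume "(x, K) \<in> k ` I'"
        then obtain y where "(x, y) \<in> I" "K = {min x y..max x y}" using I' C by (auto simp: k_def)
        then show "x \<in> K" "K \<subseteq> cbox a b" "\<exists>a b. K = cbox a b" by (auto simp: I_def)
      next
        fix x1 K1 x2 K2
        assume *: "(x1, K1) \<in> k ` I' \<and> (x2, K2) \<in> k ` I' \<and> (x1, K1) \<noteq> (x2, K2)"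
        then obtain i j where "i \<in> I'" "j \<in> I'" "(x1, K1) = k i" "(x2, K2) = k j" by blast
        moreover have "i \<noteq> j" using * calculation by auto
        moreover have "K1 = cball (m i) (r i)" "K2 = cball (m j) (r j)"
          using calculation snd_k [of i] snd_k [of j] by (auto dest: sym)
        ultimately have "K1 \<inter> K2 = {}" using disj'[of i j] by simp
        then show "interior K1 \<inter> interior K2 = {}" using interior_subset by blast
      qed
      have "\<gamma> fine k ` I'"
        using I' C by (auto simp: fine_def k_def I_def)
      note lt = \<gamma> [OF p this]
      \<comment> \<open>Exchanging the endpoints changes the sign of both terms, so the Henstock
        error is \<open>R x y\<close> up to sign whichever endpoint carries the tag.\<close>
      have norm_eq: "norm (measure lborel {min x y..max x y} *\<^sub>R h x - integral {min x y..max x y} h)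
          = norm (R x y)" if "(x, y) \<in> I" for x y
      proof (cases "x \<le> y")
        case True
        then show ?thesis using that F_diff[of x y]
          by (simp add: I_def R_def norm_minus_commute)
      next
        case False
        then have mm: "min x y = y" "max x y = x" by auto
        have eq: "integral {y..x} h = F x - F y"
          using that False by (intro F_diff) (auto simp: I_def)
        show ?thesis unfolding mm eq R_def using False by (simp add: algebra_simps)
      qed
      have "measure lebesgue (\<Union>i\<in>I'. cball (m i) (r i)) \<le> (\<Sum>i\<in>I'. measure lebesgue (cball (m i) (r i)))"
        by (rule measure_UNION_le) (use I' in auto)
      also have "\<dots> \<le> (\<Sum>(x, y)\<in>I'. norm (measure lborel {min x y..max x y} *\<^sub>R h x - integral {min x y..max x y} h) / c)"
      proof (rule sum_mono, clarify)
        fix x y assume "(x, y) \<in> I'"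
        then have xy: "(x, y) \<in> I" using I' C by blast
        have "measure lebesgue (cball (m (x, y)) (r (x, y))) = \<bar>y - x\<bar>"
          unfolding cb by (auto simp: min_def max_def)
        also have "\<dots> \<le> norm (R x y) / c" using xy \<open>c > 0\<close> by (simp add: I_def field_simps)
        finally show "measure lebesgue (cball (m (x, y)) (r (x, y))) \<le>
           norm (measure lborel {min x y..max x y} *\<^sub>R h x - integral {min x y..max x y} h) / c"
          unfolding norm_eq [OF xy] .
      qed
      also have "\<dots> = (\<Sum>(x,k)\<in>k ` I'. norm (measure lborel k *\<^sub>R h x - integral k h)) / c"
        by (subst sum.reindex [OF inj]) (simp add: sum_divide_distrib k_def case_prod_unfold)
      also have "\<dots> \<le> e" using lt \<open>c > 0\<close> by (simp add: field_simps)
      finally show ?thesis .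
    qed
    have T: "?T \<in> lmeasurable" "measure lebesgue ?T \<le> e"
      by (rule fmeasurable_UN_bound [OF C(1) _ bound], simp_all)
        (rule measure_UN_bound [OF C(1) _ bound], simp_all)
    show "\<exists>T. E c \<subseteq> T \<and> T \<in> lmeasurable \<and> measure lebesgue T \<le> e"
    proof (intro exI conjI)
      show "E c \<subseteq> ?T \<union> (E c - ?T)" by blast
      show "?T \<union> (E c - ?T) \<in> lmeasurable"
        by (intro fmeasurable.Un T negligible_imp_measurable neg)
      have "measure lebesgue (?T \<union> (E c - ?T)) = measure lebesgue ?T"
        by (rule measure_negligible_symdiff [OF T(1)]) (use neg in \<open>auto intro: negligible_subset\<close>)
      then show "measure lebesgue (?T \<union> (E c - ?T)) \<le> e" using T(2) by simp
    qed
  qed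
  \<comment> \<open>Every exceptional point lies in some \<open>E c\<close> with c > 0, and
    \<open>c\<close> can be lowered to some 1/(n+1), which leaves a countable union.\<close>
  have "{x \<in> {a..b}. \<not> (F has_vector_derivative h x) (at x within {a..b})} \<subseteq> (\<Union>n. E (inverse (real (Suc n))))"
  proof
    fix x assume x: "x \<in> {x \<in> {a..b}. \<not> (F has_vector_derivative h x) (at x within {a..b})}"
    then obtain c where "c > 0" and c: "\<And>d. d > 0 \<Longrightarrow> \<exists>y\<in>{a..b}. norm (y - x) < d \<and> \<not> norm (R x y) \<le> c * norm (y - x)"
      unfolding has_vector_derivative_def has_derivative_within_alt R_def
      using bounded_linear_scaleR_left by blast
    obtain n where n: "inverse (real (Suc n)) < c" using reals_Archimedean \<open>c > 0\<close> by blast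
    have "\<exists>y\<in>{a..b}. \<bar>y - x\<bar> < d \<and> inverse (real (Suc n)) * \<bar>y - x\<bar> < norm (R x y)" if d: "d > 0" for d
    proof -
      obtain y where y: "y \<in> {a..b}" "\<bar>y - x\<bar> < d" "c * \<bar>y - x\<bar> < norm (R x y)"
        using c[OF d] by (auto simp: not_le)
      moreover have "inverse (real (Suc n)) * \<bar>y - x\<bar> \<le> c * \<bar>y - x\<bar>"
        using n by (intro mult_right_mono) auto
      ultimately show ?thesis by (intro bexI[of _ y]) auto
    qed
    then have "x \<in> E (inverse (real (Suc n)))" using x unfolding E_def by blast
    then show "x \<in> (\<Union>n. E (inverse (real (Suc n))))" by blast
  qed
  moreover have "negligible (\<Union>n. E (inverse (real (Suc n))))"
    by (intro negligible_Union_nat neg) simp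
  ultimately show ?thesis unfolding F_def [symmetric] by (rule negligible_subset [rotated])
qed

section \<open>Caratheodory equations\<close>

text \<open>The majorant \<open>v\<close> is differentiable even if \<open>u\<close> is not, and v'
  = L u \<le> L v. Hence \<open>w\<close>, which is \<open>v\<close> times the integrating factor,
  decreases from its value \<open>c\<close> at \<open>a\<close>.\<close>

lemma gronwall_integral:
  fixes u :: "real \<Rightarrow> real"
  assumes cont: "continuous_on {a..b} u" and "0 \<le> L"
    and le: "\<And>t. t \<in> {a..b} \<Longrightarrow> u t \<le> c + L * integral {a..t} u"
    and t: "t \<in> {a..b}"
  shows "u t \<le> c * exp (L * (t - a))"
proof -
  define v where "v = (\<lambda>t. c + L * integral {a..t} u)"
  define w where "w = (\<lambda>t. v t * exp (- L * (t - a)))"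
  have contI: "continuous_on {a..b} (\<lambda>t. integral {a..t} u)"
    by (intro indefinite_integral_continuous_1 integrable_continuous_real cont)
  have "w t \<le> w a"
  proof -
    have "a \<le> t" using t by auto
    then show ?thesis
    proof (rule DERIV_nonpos_imp_decreasing_open)
      fix x assume x: "a < x" "x < t"
      then have "((\<lambda>t. integral {a..t} u) has_vector_derivative u x) (at x within {a..b})"
        using t by (intro integral_has_vector_derivative cont) auto
      then have "((\<lambda>t. integral {a..t} u) has_real_derivative u x) (at x)"
        using x t by (simp add: at_within_Icc_at has_real_derivative_iff_has_vector_derivative)
      then have "(w has_real_derivative (L * u x * exp (- L * (x - a)) + v x * (exp (- L * (x - a)) * (- L)))) (at x)"
        unfolding w_def v_def by (auto intro!: derivative_eq_intros)
      moreover have "L * u x * exp (- L * (x - a)) + v x * (exp (- L * (x - a)) * (- L))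
          = - (L * (v x - u x) * exp (- L * (x - a)))" by (simp add: algebra_simps)
      moreover have "0 \<le> L * (v x - u x) * exp (- L * (x - a))"
        using le[of x] x t \<open>0 \<le> L\<close> by (auto simp: v_def)
      ultimately show "\<exists>y. (w has_real_derivative y) (at x) \<and> y \<le> 0" by (metis neg_le_0_iff_le)
    next
      show "continuous_on {a..t} w"
        unfolding w_def v_def using t
        by (intro continuous_intros continuous_on_subset [OF contI]) auto
    qed
  qed
  also have "w a = c" by (simp add: w_def v_def)
  finally have "w t * exp (L * (t - a)) \<le> c * exp (L * (t - a))" by simp
  moreover have "w t * exp (L * (t - a)) = v t"
    by (simp add: w_def mult.assoc flip: exp_add)
  ultimately have "v t \<le> c * exp (L * (t - a))" by simp
  then show ?thesis using le [OF t] by (simp add: v_def)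
qed

text \<open>Joint measurability of \<open>g\<close> is not given. If the argument of
  \<open>y\<close> is rounded to a grid, the composite is pieced together from countably many
  measurable functions; continuity in the state then passes to the limit of finer grids.\<close>

lemma caratheodory_comp_measurable:
  fixes g :: "real \<Rightarrow> 'a::metric_space \<Rightarrow> 'b::metric_space"
  assumes cont: "\<And>t. t \<in> {a..b} \<Longrightarrow> continuous_on UNIV (g t)"
    and meas: "\<And>x. (\<lambda>t. g t x) \<in> borel_measurable (restrict_space borel {a..b})"
    and y: "continuous_on {a..b} y"
  shows "(\<lambda>t. g t (y t)) \<in> borel_measurable (restrict_space borel {a..b})"
proof (rule borel_measurable_LIMSEQ_metric)
  \<comment> \<open>Rounding down relative to \<open>a\<close> keeps \<open>q m t\<close> between
    \<open>a\<close> and \<open>t\<close>, where \<open>y\<close> is known to be continuous.\<close>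
  define q where "q = (\<lambda>m t. a + real_of_int \<lfloor>(t - a) * real (Suc m)\<rfloor> / real (Suc m))"
  show "(\<lambda>t. g t (y (q m t))) \<in> borel_measurable (restrict_space borel {a..b})" for m
    unfolding q_def
  proof (rule measurable_compose_countable [where f = "\<lambda>i t. g t (y (a + real_of_int i / real (Suc m)))"])
    show "(\<lambda>t. \<lfloor>(t - a) * real (Suc m)\<rfloor>) \<in> restrict_space borel {a..b} \<rightarrow>\<^sub>M count_space UNIV"
      by (intro measurable_restrict_space1) measurable
  qed (rule meas)
  fix t assume "t \<in> space (restrict_space borel {a..b})"
  then have t: "t \<in> {a..b}" by (simp add: space_restrict_space)
  have q: "q m t \<le> t \<and> a \<le> q m t \<and> t - inverse (real (Suc m)) \<le> q m t" for m
  proof -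
    define N k where "N = real (Suc m)" and "k = \<lfloor>(t - a) * N\<rfloor>"
    have "N > 0" by (simp add: N_def)
    have "real_of_int k \<le> (t - a) * N" "(t - a) * N - 1 \<le> real_of_int k"
      unfolding k_def by linarith+
    then have "real_of_int k / N \<le> (t - a) * N / N" "((t - a) * N - 1) / N \<le> real_of_int k / N"
      using \<open>N > 0\<close> by (simp_all only: divide_right_mono less_imp_le)
    moreover have "(t - a) * N / N = t - a" "((t - a) * N - 1) / N = t - a - inverse N"
      using \<open>N > 0\<close> by (simp_all add: field_simps)
    moreover have "0 \<le> real_of_int k / N" using t \<open>N > 0\<close> by (simp add: k_def)
    ultimately show ?thesis unfolding q_def N_def [symmetric] k_def [symmetric] by linarith
  qed
  have "(\<lambda>m. q m t) \<longlonglongrightarrow> t"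
  proof (rule tendsto_sandwich [of "\<lambda>m. t - inverse (real (Suc m))" _ _ "\<lambda>_. t"])
    show "(\<lambda>m. t - inverse (real (Suc m))) \<longlonglongrightarrow> t"
      using tendsto_diff [OF tendsto_const LIMSEQ_inverse_real_of_nat, of t] by simp
  qed (use q in auto)
  then have "(\<lambda>m. y (q m t)) \<longlonglongrightarrow> y t"
    using q t by (intro continuous_on_tendsto_compose [OF y]) (auto intro!: always_eventually intro: order_trans)
  then show "(\<lambda>m. g t (y (q m t))) \<longlonglongrightarrow> g t (y t)"
    by (intro continuous_on_tendsto_compose [OF cont [OF t]]) auto
qed

text \<open>The assumption \<open>int\<close> makes the Picard map \<open>P\<close> defined on all
  continuous functions. The iterates are summed as a telescoping series, which gives a uniform limit
  and hence a continuous one; \<open>P\<close> is continuous for the supremum norm, so the limit is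
  a fixed point.\<close>

lemma picard_lindeloef_integral_exists:
  fixes g :: "real \<Rightarrow> 'a::euclidean_space \<Rightarrow> 'a"
  assumes "L > 0"
    and int: "\<And>y. continuous_on {a..b} y \<Longrightarrow> (\<lambda>t. g t (y t)) integrable_on {a..b}"
    and Lip: "\<And>t x y. t \<in> {a..b} \<Longrightarrow> norm (g t x - g t y) \<le> L * norm (x - y)"
  obtains y where "continuous_on {a..b} y"
    "\<And>t. t \<in> {a..b} \<Longrightarrow> y t = x0 + integral {a..t} (\<lambda>s. g s (y s))"
proof -
  define P where "P = (\<lambda>y t. x0 + integral {a..t} (\<lambda>s. g s (y s)))"
  define Y where "Y = (\<lambda>m. (P ^^ m) (\<lambda>_. x0))"
  have Y_Suc: "Y (Suc m) = P (Y m)" for m by (simp add: Y_def)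
  have int': "(\<lambda>s. g s (y s)) integrable_on {a..t}" if "continuous_on {a..b} y" "t \<in> {a..b}" for y t
    by (rule integrable_subinterval_real [OF int [OF that(1)]]) (use that in auto)
  have contP: "continuous_on {a..b} (P y)" if "continuous_on {a..b} y" for y
    unfolding P_def by (intro continuous_intros indefinite_integral_continuous_1 int that)
  have contY: "continuous_on {a..b} (Y m)" for m
    by (induction m) (simp add: Y_def, simp add: Y_Suc contP)
  \<comment> \<open>The majorant \<open>v\<close> is left free: an exponential in the contraction
    estimate, a constant in the passage to the limit.\<close>
  have diffP: "norm (P y t - P z t) \<le> integral {a..t} v"
    if "continuous_on {a..b} y" "continuous_on {a..b} z" "continuous_on {a..b} v" "t \<in> {a..b}"
      "\<And>s. s \<in> {a..b} \<Longrightarrow> L * norm (y s - z s) \<le> v s" for y z v t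
  proof -
    have "P y t - P z t = integral {a..t} (\<lambda>s. g s (y s) - g s (z s))"
      unfolding P_def using that by (subst integral_diff) (auto intro: int')
    also have "norm \<dots> \<le> integral {a..t} v"
    proof (rule Henstock_Kurzweil_Integration.integral_norm_bound_integral)
      show "(\<lambda>s. g s (y s) - g s (z s)) integrable_on {a..t}"
        using that by (intro integrable_diff int')
      show "v integrable_on {a..t}"
        using that by (intro integrable_continuous_real) (auto intro: continuous_on_subset)
      show "norm (g s (y s) - g s (z s)) \<le> v s" if "s \<in> {a..t}" for s
        using Lip[of s "y s" "z s"] that \<open>t \<in> {a..b}\<close> \<open>\<And>s. s \<in> {a..b} \<Longrightarrow> L * norm (y s - z s) \<le> v s\<close> [of s]
        by simp
    qed
    finally show ?thesis .
  qed
  have cpt: "compact ((\<lambda>t. Y 1 t - Y 0 t) ` {a..b})"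
    by (intro compact_continuous_image continuous_intros contY) simp
  obtain C where "C > 0" and "\<forall>x\<in>(\<lambda>t. Y 1 t - Y 0 t) ` {a..b}. norm x \<le> C"
    using bounded_pos [THEN iffD1, OF compact_imp_bounded [OF cpt]] by blast
  then have C: "norm (Y 1 t - Y 0 t) \<le> C" if "t \<in> {a..b}" for t
    using that by blast
  \<comment> \<open>In the norm weighted by \<open>exp (- 2 * L * (t - a))\<close> the Picard map contracts by \<open>1/2\<close>.\<close>
  have step: "norm (Y (Suc m) t - Y m t) \<le> C * (1/2) ^ m * exp (2 * L * (t - a))" if "t \<in> {a..b}" for m t
    using that
  proof (induction m arbitrary: t)
    case 0
    have "C * 1 \<le> C * exp (2 * L * (t - a))"
      using 0 \<open>L > 0\<close> \<open>C > 0\<close> by (intro mult_left_mono) auto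
    then show ?case using C[OF 0] by simp
  next
    case (Suc m)
    let ?v = "\<lambda>s. L * (C * (1/2) ^ m * exp (2 * L * (s - a)))"
    let ?V = "\<lambda>s. C * (1/2) ^ Suc m * exp (2 * L * (s - a))"
    have "norm (Y (Suc (Suc m)) t - Y (Suc m) t) \<le> integral {a..t} ?v"
      unfolding Y_Suc [of "Suc m"] Y_Suc [of m]
      using Suc.IH \<open>L > 0\<close> unfolding Y_Suc [of m]
      by (intro diffP contP contY continuous_intros Suc.prems mult_left_mono) auto
    \<comment> \<open>The exponent 2 L, twice the Lipschitz constant, is the source of the 1/2: the
      antiderivative of L exp (2 L (s - a)) is half the exponential.\<close>
    also have "integral {a..t} ?v = ?V t - ?V a"
      using Suc.prems
      by (intro integral_unique fundamental_theorem_of_calculus)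
        (auto intro!: derivative_eq_intros simp flip: has_real_derivative_iff_has_vector_derivative)
    also have "\<dots> \<le> ?V t" using \<open>C > 0\<close> by simp
    finally show ?case .
  qed
  let ?M = "\<lambda>m. C * exp (2 * L * (b - a)) * (1/2) ^ m"
  define y where "y = (\<lambda>t. (\<Sum>m. Y (Suc m) t - Y m t) + x0)"
  have "uniform_limit {a..b} (\<lambda>n t. \<Sum>m<n. Y (Suc m) t - Y m t) (\<lambda>t. \<Sum>m. Y (Suc m) t - Y m t) sequentially"
  proof (rule Weierstrass_m_test)
    show "norm (Y (Suc m) t - Y m t) \<le> ?M m" if "t \<in> {a..b}" for m t
    proof -
      have "C * (1/2) ^ m * exp (2 * L * (t - a)) \<le> C * (1/2) ^ m * exp (2 * L * (b - a))"
        using that \<open>L > 0\<close> \<open>C > 0\<close> by (intro mult_left_mono) auto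
      then show ?thesis using step [OF that, of m] by (simp add: mult_ac)
    qed
    show "summable ?M" by (intro summable_mult summable_geometric) simp
  qed
  then have "uniform_limit {a..b} (\<lambda>n t. (\<Sum>m<n. Y (Suc m) t - Y m t) + x0) y sequentially"
    unfolding y_def by (intro uniform_limit_add uniform_limit_const)
  moreover have "(\<Sum>m<n. Y (Suc m) t - Y m t) + x0 = Y n t" for n t
    by (subst sum_lessThan_telescope) (simp add: Y_def)
  ultimately have lim: "uniform_limit {a..b} Y y sequentially" by simp
  then have conty: "continuous_on {a..b} y"
    by (rule uniform_limit_theorem [rotated]) (auto simp: contY)
  have "y t = P y t" if t: "t \<in> {a..b}" for t
  proof (rule LIMSEQ_unique)
    show "(\<lambda>n. Y (Suc n) t) \<longlonglongrightarrow> y t"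
      using tendsto_uniform_limitI [OF lim t] by (rule LIMSEQ_Suc)
    show "(\<lambda>n. Y (Suc n) t) \<longlonglongrightarrow> P y t"
    proof (rule tendstoI)
      fix e :: real assume "e > 0"
      \<comment> \<open>A uniform error \<open>d\<close> in an iterate changes its image under
        \<open>P\<close> by at most L d (b - a); the summand 1 covers \<open>a = b\<close>.\<close>
      define d where "d = e / (L * (b - a) + 1)"
      have "L * (b - a) \<ge> 0" using t \<open>L > 0\<close> by simp
      then have "d > 0" and d: "L * d * (b - a) < e" using \<open>e > 0\<close> by (auto simp: d_def field_simps)
      have "\<forall>\<^sub>F n in sequentially. \<forall>s\<in>{a..b}. dist (Y n s) (y s) < d"
        using lim \<open>d > 0\<close> by (rule uniform_limitD)
      then show "\<forall>\<^sub>F n in sequentially. dist (Y (Suc n) t) (P y t) < e"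
      proof eventually_elim
        case (elim n)
        have "norm (P (Y n) t - P y t) \<le> integral {a..t} (\<lambda>_. L * d)"
        proof (rule diffP)
          show "L * norm (Y n s - y s) \<le> L * d" if "s \<in> {a..b}" for s
            using elim[rule_format, OF that] \<open>L > 0\<close> by (simp add: dist_norm)
        qed (use contY conty t in auto)
        also have "\<dots> = L * d * (t - a)" using t by simp
        also have "\<dots> \<le> L * d * (b - a)" using t \<open>L > 0\<close> \<open>d > 0\<close> by (intro mult_left_mono) auto
        finally show ?case using d by (simp add: Y_Suc dist_norm)
      qed
    qed
  qed
  then show thesis using that conty unfolding P_def by blast
qed

text \<open>Gronwall with constant 0 for the norm of the difference. The Lipschitz condition is
  asked only along the two given functions.\<close>

lemma lipschitz_ode_unique:
  fixes y z :: "real \<Rightarrow> 'a::euclidean_space"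
  assumes "continuous_on {a..b} y" "continuous_on {a..b} z" "0 \<le> L" "y a = z a"
    and Lip: "\<And>s. s \<in> {a..b} \<Longrightarrow> norm (g s (y s) - g s (z s)) \<le> L * norm (y s - z s)"
    and y: "\<And>t. t \<in> {a..b} \<Longrightarrow> ((\<lambda>s. g s (y s)) has_integral y t - y a) {a..t}"
    and z: "\<And>t. t \<in> {a..b} \<Longrightarrow> ((\<lambda>s. g s (z s)) has_integral z t - z a) {a..t}"
    and t: "t \<in> {a..b}"
  shows "y t = z t"
proof -
  have cont: "continuous_on {a..b} (\<lambda>s. norm (y s - z s))"
    by (intro continuous_intros assms)
  have "norm (y t - z t) \<le> 0 * exp (L * (t - a))"
  proof (rule gronwall_integral [OF cont \<open>0 \<le> L\<close> _ t])
    fix t assume t: "t \<in> {a..b}"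
    have int: "(\<lambda>s. L * norm (y s - z s)) integrable_on {a..t}"
      using t by (intro integrable_continuous_real continuous_intros) (auto intro: continuous_on_subset assms)
    have "((\<lambda>s. g s (y s) - g s (z s)) has_integral (y t - y a) - (z t - z a)) {a..t}"
      by (intro has_integral_diff y z t)
    then have hi: "((\<lambda>s. g s (y s) - g s (z s)) has_integral (y t - z t)) {a..t}"
      using \<open>y a = z a\<close> by simp
    have "norm (y t - z t) \<le> integral {a..t} (\<lambda>s. L * norm (y s - z s))"
      unfolding integral_unique [OF hi, symmetric]
    proof (rule Henstock_Kurzweil_Integration.integral_norm_bound_integral [OF _ int])
      show "(\<lambda>s. g s (y s) - g s (z s)) integrable_on {a..t}" using hi by blast
      show "norm (g s (y s) - g s (z s)) \<le> L * norm (y s - z s)" if "s \<in> {a..t}" for s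
        using that t by (intro Lip) auto
    qed
    then show "norm (y t - z t) \<le> 0 + L * integral {a..t} (\<lambda>s. norm (y s - z s))" by simp
  qed
  then show ?thesis by simp
qed

text \<open>Integrating B (1 + |y|) produces B (t - a) \<le> B (b - a), which joins the constant in
  Gronwall's inequality, and the integral of B |y|, which drives the exponential.\<close>

lemma sublinear_growth_bound:
  fixes y :: "real \<Rightarrow> 'a::euclidean_space"
  assumes cont: "continuous_on {a..b} y" and "0 \<le> B"
    and y: "\<And>t. t \<in> {a..b} \<Longrightarrow> (h has_integral y t - y a) {a..t}"
    and h: "\<And>s. s \<in> {a..b} \<Longrightarrow> norm (h s) \<le> B * (1 + norm (y s))"
    and t: "t \<in> {a..b}"
  shows "norm (y t) \<le> (norm (y a) + B * (b - a)) * exp (B * (b - a))"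
proof -
  have "norm (y t) \<le> (norm (y a) + B * (b - a)) * exp (B * (t - a))"
  proof (rule gronwall_integral [OF _ \<open>0 \<le> B\<close> _ t])
    show "continuous_on {a..b} (\<lambda>s. norm (y s))" by (intro continuous_intros cont)
    fix t assume t: "t \<in> {a..b}"
    have inty: "(\<lambda>s. norm (y s)) integrable_on {a..t}"
      using t by (intro integrable_continuous_real continuous_intros) (auto intro: continuous_on_subset cont)
    have int: "(\<lambda>s. B + B * norm (y s)) integrable_on {a..t}"
      using t by (intro integrable_continuous_real continuous_intros) (auto intro: continuous_on_subset cont)
    have "norm (y t - y a) \<le> integral {a..t} (\<lambda>s. B + B * norm (y s))"
      unfolding integral_unique [OF y [OF t], symmetric]
    proof (rule Henstock_Kurzweil_Integration.integral_norm_bound_integral [OF _ int])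
      show "h integrable_on {a..t}" using y [OF t] by blast
      show "norm (h s) \<le> B + B * norm (y s)" if "s \<in> {a..t}" for s
        using h[of s] that t by (simp add: algebra_simps)
    qed
    also have "\<dots> = B * (t - a) + B * integral {a..t} (\<lambda>s. norm (y s))"
      using t inty by (subst integral_add) (auto intro: integrable_on_mult_right)
    also have "B * (t - a) \<le> B * (b - a)" using t \<open>0 \<le> B\<close> by (intro mult_left_mono) auto
    finally show "norm (y t) \<le> norm (y a) + B * (b - a) + B * integral {a..t} (\<lambda>s. norm (y s))"
      using norm_triangle_sub [of "y t" "y a"] by simp
  qed
  also have "\<dots> \<le> (norm (y a) + B * (b - a)) * exp (B * (b - a))"
    using t \<open>0 \<le> B\<close> by (intro mult_left_mono) (auto intro!: mult_left_mono add_nonneg_nonneg)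
  finally show ?thesis .
qed

section \<open>The delay equation\<close>

text \<open>\<open>N\<close> counts the steps of length \<tau>; it is n + 1 in the theorem.\<close>

locale sublinear_dde =
  fixes f :: "real \<Rightarrow> 'a::euclidean_space \<Rightarrow> 'a \<Rightarrow> 'a" and \<phi> :: "real \<Rightarrow> 'a"
    and \<tau> K L :: real and N :: nat
  assumes \<tau>: "\<tau> > 0" and K: "K > 0" and L: "L > 0"
    and cont_f: "\<And>t. t \<in> {0..real N * \<tau>} \<Longrightarrow> continuous_on UNIV (\<lambda>(x, z). f t x z)"
    and cont_\<phi>: "continuous_on {- \<tau>..0} \<phi>"
    and meas_f: "\<And>x z. (\<lambda>t. f t x z) \<in> borel_measurable (restrict_space borel {0..real N * \<tau>})"
    and bound_f: "\<And>t x z. t \<in> {0..real N * \<tau>} \<Longrightarrow> norm (f t x z) \<le> K * (1 + norm x) * (1 + norm z)"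
    and Lip_f: "\<And>t x1 x2 z. t \<in> {0..real N * \<tau>} \<Longrightarrow>
       norm (f t x1 z - f t x2 z) \<le> L * (1 + norm z) * norm (x1 - x2)"
begin

text \<open>The number \<open>k\<close> of steps already solved is a parameter, so that the method
  of steps becomes an induction on \<open>k\<close>; for \<open>k = 0\<close> only the initial
  function remains.\<close>

definition integral_solution :: "nat \<Rightarrow> (real \<Rightarrow> 'a) \<Rightarrow> bool" where
  "integral_solution k x \<longleftrightarrow> continuous_on {- \<tau>..real k * \<tau>} x \<and> (\<forall>t\<in>{- \<tau>..0}. x t = \<phi> t) \<and>
     (\<forall>t\<in>{0..real k * \<tau>}. ((\<lambda>s. f s (x s) (x (s - \<tau>))) has_integral x t - x 0) {0..t})"

text \<open>Delayed times stay above -\<tau>, so values off the interval do not matter. This lets a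
  solution be replaced by its restriction.\<close>

lemma integral_solution_cong:
  assumes "\<And>t. t \<in> {- \<tau>..real k * \<tau>} \<Longrightarrow> x t = y t" "integral_solution k x"
  shows "integral_solution k y"
  unfolding integral_solution_def
proof (intro conjI ballI)
  have k: "0 \<le> real k * \<tau>" using \<tau> by simp
  show "continuous_on {- \<tau>..real k * \<tau>} y"
    by (rule continuous_on_eq [of _ x]) (use assms in \<open>auto simp: integral_solution_def\<close>)
  show "y t = \<phi> t" if "t \<in> {- \<tau>..0}" for t
  proof -
    have "t \<in> {- \<tau>..real k * \<tau>}" using that order_trans [OF _ k, of t] by simp
    then show ?thesis using assms that by (metis integral_solution_def)
  qed
  fix t assume t: "t \<in> {0..real k * \<tau>}"
  have "((\<lambda>s. f s (x s) (x (s - \<tau>))) has_integral x t - x 0) {0..t}"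
    using t assms(2) by (simp add: integral_solution_def)
  moreover have "x t = y t" "x 0 = y 0" using t k \<tau> by (auto intro!: assms(1))
  moreover have "f s (x s) (x (s - \<tau>)) = f s (y s) (y (s - \<tau>))" if "s \<in> {0..t}" for s
    using that t \<tau> assms(1)[of s] assms(1)[of "s - \<tau>"] by auto
  ultimately show "((\<lambda>s. f s (y s) (y (s - \<tau>))) has_integral y t - y 0) {0..t}"
    using has_integral_eq by (metis (no_types, lifting))
qed

lemma integral_solution_mono:
  assumes "integral_solution k x" "j \<le> k"
  shows "integral_solution j x"
proof -
  have "real j * \<tau> \<le> real k * \<tau>" using assms(2) \<tau> by simp
  then show ?thesis using assms(1) unfolding integral_solution_def
    by (auto intro: continuous_on_subset)
qed

lemma integral_solution_diff:
  assumes x: "integral_solution k x" and "0 \<le> s" "s \<le> t" "t \<le> real k * \<tau>"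
  shows "((\<lambda>s. f s (x s) (x (s - \<tau>))) has_integral x t - x s) {s..t}"
proof -
  let ?h = "\<lambda>s. f s (x s) (x (s - \<tau>))"
  have s: "(?h has_integral x s - x 0) {0..s}" and t: "(?h has_integral x t - x 0) {0..t}"
    using assms by (auto simp: integral_solution_def)
  have int: "?h integrable_on {s..t}"
    by (rule integrable_subinterval_real [OF has_integral_integrable [OF t]]) (use assms in auto)
  have "integral {0..s} ?h + integral {s..t} ?h = integral {0..t} ?h"
    using assms t by (intro Henstock_Kurzweil_Integration.integral_combine) auto
  then have "integral {s..t} ?h = x t - x s"
    using integral_unique [OF s] integral_unique [OF t] by (simp add: algebra_simps)
  with int show ?thesis by (simp add: has_integral_iff)
qed

text \<open>State and delayed value are treated as one continuous path in the product space, which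
  gives measurability; A3 supplies a continuous majorant.\<close>

lemma nonlinearity_integrable:
  assumes y: "continuous_on {a..b} y" and z: "continuous_on {a..b} z" and "0 \<le> a" "b \<le> real N * \<tau>"
  shows "(\<lambda>t. f t (y t) (z t)) integrable_on {a..b}"
proof -
  have sub: "{a..b} \<subseteq> {0..real N * \<tau>}" using assms by auto
  have "(\<lambda>t. (case (y t, z t) of (x, z) \<Rightarrow> f t x z)) \<in> borel_measurable (restrict_space borel {a..b})"
  proof (rule caratheodory_comp_measurable [where g = "\<lambda>t (x, z). f t x z"])
    show "continuous_on UNIV (\<lambda>(x, z). f t x z)" if "t \<in> {a..b}" for t
      using that sub by (intro cont_f) auto
    show "(\<lambda>t. (case p of (x, z) \<Rightarrow> f t x z)) \<in> borel_measurable (restrict_space borel {a..b})" for p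
      using measurable_restrict_mono [OF meas_f sub, of "fst p" "snd p"] by (simp add: case_prod_unfold)
    show "continuous_on {a..b} (\<lambda>t. (y t, z t))" by (intro continuous_intros y z)
  qed
  \<comment> \<open>Borel measurability on the interval becomes Lebesgue measurability through the
    extension by zero.\<close>
  then have "(\<lambda>t. indicat_real {a..b} t *\<^sub>R f t (y t) (z t)) \<in> borel_measurable lborel"
    by (simp add: borel_measurable_restrict_space_iff)
  then have meas: "(\<lambda>t. f t (y t) (z t)) \<in> borel_measurable (lebesgue_on {a..b})"
    by (simp add: borel_measurable_restrict_space_iff measurable_completion)
  show ?thesis
  proof (rule measurable_bounded_by_integrable_imp_integrable [OF meas])
    show "(\<lambda>t. K * (1 + norm (y t)) * (1 + norm (z t))) integrable_on {a..b}"
      by (intro integrable_continuous_real continuous_intros y z)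
    show "norm (f t (y t) (z t)) \<le> K * (1 + norm (y t)) * (1 + norm (z t))" if "t \<in> {a..b}" for t
      using that sub by (intro bound_f) auto
  qed auto
qed

text \<open>The constant in A4 grows with the delayed value, but \<open>z\<close> is bounded on the
  compact interval.\<close>

lemma Lipschitz_const_exists:
  assumes z: "continuous_on {a..b} z" and "0 \<le> a" "b \<le> real N * \<tau>"
  obtains \<Lambda> where "\<Lambda> > 0" "\<And>t x1 x2. t \<in> {a..b} \<Longrightarrow> norm (f t x1 (z t) - f t x2 (z t)) \<le> \<Lambda> * norm (x1 - x2)"
proof -
  have cpt: "compact (z ` {a..b})" by (intro compact_continuous_image z) simp
  obtain B where "B > 0" and "\<forall>x\<in>z ` {a..b}. norm x \<le> B"
    using bounded_pos [THEN iffD1, OF compact_imp_bounded [OF cpt]] by blast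
  then have B: "norm (z t) \<le> B" if "t \<in> {a..b}" for t using that by blast
  show ?thesis
  proof (rule that)
    show "L * (1 + B) > 0" using L \<open>B > 0\<close> by simp
    fix t x1 x2 assume t: "t \<in> {a..b}"
    have "norm (f t x1 (z t) - f t x2 (z t)) \<le> L * (1 + norm (z t)) * norm (x1 - x2)"
      using t assms by (intro Lip_f) auto
    also have "\<dots> \<le> L * (1 + B) * norm (x1 - x2)"
      using L B [OF t] by (intro mult_right_mono mult_left_mono) auto
    finally show "norm (f t x1 (z t) - f t x2 (z t)) \<le> L * (1 + B) * norm (x1 - x2)" .
  qed
qed

section \<open>Existence and uniqueness by the method of steps\<close>

lemma delay_continuous:
  assumes "integral_solution k x"
  shows "continuous_on {real k * \<tau>..real (Suc k) * \<tau>} (\<lambda>s. x (s - \<tau>))"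
proof (rule continuous_on_compose2 [where g = x])
  show "continuous_on {- \<tau>..real k * \<tau>} x" using assms by (simp add: integral_solution_def)
  have "0 \<le> real k * \<tau>" using \<tau> by simp
  then show "(\<lambda>s. s - \<tau>) ` {real k * \<tau>..real (Suc k) * \<tau>} \<subseteq> {- \<tau>..real k * \<tau>}"
    by (auto simp: algebra_simps)
qed (intro continuous_intros)

lemma integral_solution_exists: "k \<le> N \<Longrightarrow> \<exists>x. integral_solution k x"
proof (induction k)
  case 0
  have "integral_solution 0 \<phi>" using cont_\<phi> by (auto simp: integral_solution_def has_integral_refl)
  then show ?case by blast
next
  case (Suc k)
  then obtain x where x: "integral_solution k x" by auto
  define a b where "a = real k * \<tau>" and "b = real (Suc k) * \<tau>"
  have ab: "0 \<le> a" "b = a + \<tau>" "a < b" using \<tau> by (auto simp: a_def b_def algebra_simps)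
  have bN: "b \<le> real N * \<tau>" unfolding b_def using Suc.prems \<tau> by (intro mult_right_mono) auto
  have contz: "continuous_on {a..b} (\<lambda>s. x (s - \<tau>))"
    unfolding a_def b_def by (rule delay_continuous [OF x])
  obtain \<Lambda> where "\<Lambda> > 0" and \<Lambda>: "\<And>t x1 x2. t \<in> {a..b} \<Longrightarrow>
      norm (f t x1 (x (t - \<tau>)) - f t x2 (x (t - \<tau>))) \<le> \<Lambda> * norm (x1 - x2)"
    using Lipschitz_const_exists [OF contz ab(1) bN] by metis
  obtain y where conty: "continuous_on {a..b} y"
    and y: "\<And>t. t \<in> {a..b} \<Longrightarrow> y t = x a + integral {a..t} (\<lambda>s. f s (y s) (x (s - \<tau>)))"
  proof (rule picard_lindeloef_integral_exists [OF \<open>\<Lambda> > 0\<close>, of a b "\<lambda>s v. f s v (x (s - \<tau>))"])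
    show "(\<lambda>t. f t (y t) (x (t - \<tau>))) integrable_on {a..b}" if "continuous_on {a..b} y" for y
      by (rule nonlinearity_integrable [OF that contz ab(1) bN])
  qed (use \<Lambda> in auto)
  have ya: "y a = x a" using y[of a] ab by simp
  define w where "w = (\<lambda>t. if t \<le> a then x t else y t)"
  have wx: "w t = x t" if "t \<le> a" for t using that by (simp add: w_def)
  have wy: "w t = y t" if "a \<le> t" for t using that ya by (auto simp: w_def)
  have "integral_solution (Suc k) w"
    unfolding integral_solution_def b_def [symmetric]
  proof (intro conjI ballI)
    have "continuous_on ({- \<tau>..a} \<union> {a..b}) w"
      unfolding w_def
      by (rule continuous_on_cases) (use x conty ya in \<open>auto simp: integral_solution_def a_def\<close>)
    moreover have "{- \<tau>..a} \<union> {a..b} = {- \<tau>..b}" using ab \<tau> by auto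
    ultimately show "continuous_on {- \<tau>..b} w" by simp
    show "w t = \<phi> t" if "t \<in> {- \<tau>..0}" for t
      using that x ab wx[of t] by (auto simp: integral_solution_def)
    fix t assume t: "t \<in> {0..b}"
    have left: "((\<lambda>s. f s (w s) (w (s - \<tau>))) has_integral x t - x 0) {0..t}" if "0 \<le> t" "t \<le> a" for t
    proof (rule has_integral_eq)
      show "((\<lambda>s. f s (x s) (x (s - \<tau>))) has_integral x t - x 0) {0..t}"
        using x that by (auto simp: integral_solution_def a_def)
      show "f s (x s) (x (s - \<tau>)) = f s (w s) (w (s - \<tau>))" if "s \<in> {0..t}" for s
        using that \<open>t \<le> a\<close> \<tau> by (simp add: wx)
    qed
    show "((\<lambda>s. f s (w s) (w (s - \<tau>))) has_integral w t - w 0) {0..t}"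
    proof (cases "t \<le> a")
      case True
      then show ?thesis using left[of t] t ab by (simp add: wx)
    next
      case False
      have "((\<lambda>s. f s (w s) (w (s - \<tau>))) has_integral y t - y a) {a..t}"
      proof (rule has_integral_eq)
        have "(\<lambda>s. f s (y s) (x (s - \<tau>))) integrable_on {a..t}"
          by (rule integrable_subinterval_real [OF nonlinearity_integrable [OF conty contz ab(1) bN]])
            (use t in auto)
        then show "((\<lambda>s. f s (y s) (x (s - \<tau>))) has_integral y t - y a) {a..t}"
          using y[of t] t False ya by (simp add: has_integral_iff)
        \<comment> \<open>As b = a + \<tau>, the delayed time is at most \<open>a\<close>, where
          \<open>w\<close> is still the old solution \<open>x\<close>.\<close>
        show "f s (y s) (x (s - \<tau>)) = f s (w s) (w (s - \<tau>))" if "s \<in> {a..t}" for s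
          using that t ab by (simp add: wx wy)
      qed
      from has_integral_combine [OF _ _ left [OF ab(1) order_refl] this] False ab ya
      show ?thesis by (simp add: wx wy)
    qed
  qed
  then show ?case by blast
qed

text \<open>By induction both solutions have the same delayed values on the last step, so there they
  solve the same equation without delay and start from the same point.\<close>

lemma integral_solution_unique:
  assumes "integral_solution k x" "integral_solution k y" "k \<le> N" "t \<in> {- \<tau>..real k * \<tau>}"
  shows "x t = y t"
  using assms
proof (induction k arbitrary: t)
  case 0
  then show ?case by (auto simp: integral_solution_def)
next
  case (Suc k)
  define a b where "a = real k * \<tau>" and "b = real (Suc k) * \<tau>"
  have ab: "0 \<le> a" "b = a + \<tau>" "a < b" using \<tau> by (auto simp: a_def b_def algebra_simps)
  have bN: "b \<le> real N * \<tau>" unfolding b_def using Suc.prems \<tau> by (intro mult_right_mono) auto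
  have k: "integral_solution k x" "integral_solution k y"
    using Suc.prems integral_solution_mono by (meson Suc_leD order_refl)+
  have eq: "x s = y s" if "s \<in> {- \<tau>..a}" for s
    using Suc.IH [OF k] Suc.prems that unfolding a_def by simp
  show ?case
  proof (cases "t \<le> a")
    case True
    then show ?thesis using eq[of t] Suc.prems by simp
  next
    case False
    then have t: "t \<in> {a..b}" using Suc.prems by (simp add: b_def)
    have contz: "continuous_on {a..b} (\<lambda>s. x (s - \<tau>))"
      unfolding a_def b_def by (rule delay_continuous [OF k(1)])
    obtain \<Lambda> where "\<Lambda> > 0" and \<Lambda>: "\<And>t x1 x2. t \<in> {a..b} \<Longrightarrow>
        norm (f t x1 (x (t - \<tau>)) - f t x2 (x (t - \<tau>))) \<le> \<Lambda> * norm (x1 - x2)"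
      using Lipschitz_const_exists [OF contz ab(1) bN] by metis
    show ?thesis
    proof (rule lipschitz_ode_unique [of a b x y \<Lambda> "\<lambda>s v. f s v (x (s - \<tau>))"])
      have "{a..b} \<subseteq> {- \<tau>..b}" using ab \<tau> by auto
      moreover have "continuous_on {- \<tau>..b} x" "continuous_on {- \<tau>..b} y"
        using Suc.prems(1,2) by (simp_all add: integral_solution_def b_def)
      ultimately show "continuous_on {a..b} x" "continuous_on {a..b} y"
        using continuous_on_subset by blast+
      show "x a = y a" using eq ab \<tau> by simp
      show "((\<lambda>s. f s (x s) (x (s - \<tau>))) has_integral x t - x a) {a..t}" if "t \<in> {a..b}" for t
        using that ab by (intro integral_solution_diff [OF Suc.prems(1)]) (auto simp: b_def)
      show "((\<lambda>s. f s (y s) (x (s - \<tau>))) has_integral y t - y a) {a..t}" if "t \<in> {a..b}" for t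
      proof (rule has_integral_eq)
        show "((\<lambda>s. f s (y s) (y (s - \<tau>))) has_integral y t - y a) {a..t}"
          using that ab by (intro integral_solution_diff [OF Suc.prems(2)]) (auto simp: b_def)
        show "f s (y s) (y (s - \<tau>)) = f s (y s) (x (s - \<tau>))" if "s \<in> {a..t}" for s
          using that \<open>t \<in> {a..b}\<close> ab by (simp add: eq)
      qed
    qed (use \<Lambda> \<open>\<Lambda> > 0\<close> t in auto)
  qed
qed

section \<open>A priori bounds\<close>

abbreviation "G \<equiv> growth_const K \<tau> \<phi>"

lemma norm_initial_le: "t \<in> {- \<tau>..0} \<Longrightarrow> norm (\<phi> t) \<le> G 0"
  unfolding growth_const.simps
  by (rule cSUP_upper)
    (auto intro!: bounded_imp_bdd_above compact_imp_bounded compact_continuous_image continuous_intros cont_\<phi>)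

lemma growth_const_nonneg: "0 \<le> G j"
proof (induction j)
  case 0
  show ?case using norm_initial_le [of 0] \<tau> norm_ge_zero [of "\<phi> 0"] by (simp del: growth_const.simps norm_ge_zero)
next
  case (Suc j)
  then show ?case using K \<tau> by simp
qed

text \<open>With the shifted index, \<open>G j\<close> bounds the solution on the interval ending at
  j \<tau>; \<open>j = 0\<close> is the initial interval. The bound for one interval controls the
  delayed value on the next.\<close>

lemma integral_solution_bound:
  assumes x: "integral_solution N x"
  shows "j \<le> N \<Longrightarrow> t \<in> {(real j - 1) * \<tau>..real j * \<tau>} \<Longrightarrow> norm (x t) \<le> G j"
proof (induction j arbitrary: t)
  case 0
  then show ?case using x norm_initial_le [of t] by (simp add: integral_solution_def del: growth_const.simps)
next
  case (Suc j)
  define a b where "a = real j * \<tau>" and "b = real (Suc j) * \<tau>"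
  have ab: "0 \<le> a" "b = a + \<tau>" "a < b" using \<tau> by (auto simp: a_def b_def algebra_simps)
  have bN: "b \<le> real N * \<tau>" unfolding b_def using Suc.prems \<tau> by (intro mult_right_mono) auto
  have IH: "norm (x t) \<le> G j" if "t \<in> {a - \<tau>..a}" for t
    using Suc.IH [of t] that Suc.prems by (simp add: a_def algebra_simps)
  let ?B = "(1 + G j) * K"
  have G0: "0 \<le> G j" by (rule growth_const_nonneg)
  have B: "0 \<le> ?B" using G0 K by simp
  have "norm (x t) \<le> (norm (x a) + ?B * (b - a)) * exp (?B * (b - a))"
  proof (rule sublinear_growth_bound [OF _ B])
    show "continuous_on {a..b} x"
      using x bN ab \<tau> by (auto simp: integral_solution_def intro: continuous_on_subset)
    show "((\<lambda>s. f s (x s) (x (s - \<tau>))) has_integral x t - x a) {a..t}" if "t \<in> {a..b}" for t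
      using that ab bN by (intro integral_solution_diff [OF x]) auto
    show "t \<in> {a..b}" using Suc.prems by (simp add: a_def b_def)
    fix s assume s: "s \<in> {a..b}"
    have "norm (f s (x s) (x (s - \<tau>))) \<le> K * (1 + norm (x s)) * (1 + norm (x (s - \<tau>)))"
      using s ab bN by (intro bound_f) auto
    also have "\<dots> \<le> K * (1 + norm (x s)) * (1 + G j)"
      using s ab K by (intro mult_left_mono add_left_mono IH) auto
    finally show "norm (f s (x s) (x (s - \<tau>))) \<le> ?B * (1 + norm (x s))" by (simp add: mult_ac)
  qed
  also have "\<dots> \<le> ((1 + G j) * (1 + K * \<tau>)) * exp (?B * (b - a))"
  proof (rule mult_right_mono)
    \<comment> \<open>The starting value of a step is the end value of the previous one, and G j +
      (1 + G j) K \<tau> \<le> (1 + G j) (1 + K \<tau>).\<close>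
    have "norm (x a) \<le> G j" using \<tau> by (intro IH) auto
    then show "norm (x a) + ?B * (b - a) \<le> (1 + G j) * (1 + K * \<tau>)" using ab by (simp add: algebra_simps)
  qed simp
  finally show ?case using ab by (simp add: algebra_simps)
qed

text \<open>On this step the state is at most \<open>G (Suc j)\<close> and the delayed value, one
  interval earlier, at most \<open>G j\<close>; A3 then bounds the integrand by the claimed
  constant.\<close>

lemma integral_solution_Lipschitz:
  assumes x: "integral_solution N x" and j: "Suc j \<le> N"
    and s: "real j * \<tau> \<le> s" "s \<le> t" "t \<le> real (Suc j) * \<tau>"
  shows "norm (x t - x s) \<le> (1 + G j) * (1 + G (Suc j)) * K * (t - s)"
proof -
  have jN: "real (Suc j) * \<tau> \<le> real N * \<tau>" using j \<tau> by (intro mult_right_mono) auto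
  have j0: "0 \<le> real j * \<tau>" using \<tau> by simp
  have hi: "((\<lambda>s. f s (x s) (x (s - \<tau>))) has_integral x t - x s) {s..t}"
    using s j0 jN by (intro integral_solution_diff [OF x]) auto
  have "norm (x t - x s) \<le> integral {s..t} (\<lambda>_. (1 + G j) * (1 + G (Suc j)) * K)"
    unfolding integral_unique [OF hi, symmetric]
  proof (rule Henstock_Kurzweil_Integration.integral_norm_bound_integral)
    show "(\<lambda>s. f s (x s) (x (s - \<tau>))) integrable_on {s..t}" using hi by blast
    fix r assume r: "r \<in> {s..t}"
    have "norm (f r (x r) (x (r - \<tau>))) \<le> K * (1 + norm (x r)) * (1 + norm (x (r - \<tau>)))"
      using s r j0 jN by (intro bound_f) auto
    also have "\<dots> \<le> K * (1 + G (Suc j)) * (1 + G j)"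
    proof (intro mult_mono add_left_mono)
      show "norm (x r) \<le> G (Suc j)"
        using r s j by (intro integral_solution_bound [OF x]) (auto simp: algebra_simps)
      show "norm (x (r - \<tau>)) \<le> G j"
        using r s j by (intro integral_solution_bound [OF x]) (auto simp: algebra_simps)
    qed (use K growth_const_nonneg [of "Suc j"] in auto)
    finally show "norm (f r (x r) (x (r - \<tau>))) \<le> (1 + G j) * (1 + G (Suc j)) * K" by (simp add: mult_ac)
  qed auto
  then show ?thesis using s by (simp add: mult_ac)
qed

section \<open>Equivalence of the differential and the integral formulation\<close>

lemma dde_solution_imp_integral_solution:
  assumes x: "dde_solution f \<phi> \<tau> (real N * \<tau>) x"
  shows "integral_solution N x"
proof -
  let ?T = "real N * \<tau>" and ?h = "\<lambda>s. f s (x s) (x (s - \<tau>))"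
  have AC: "absolutely_continuous_on {0..?T} x" and init: "\<And>t. t \<in> {- \<tau>..0} \<Longrightarrow> x t = \<phi> t"
    and ae: "AE t\<in>{0..?T} in lebesgue. (x has_vector_derivative ?h t) (at t within {0..?T})"
    using x by (auto simp: dde_solution_def)
  have T: "0 \<le> ?T" using \<tau> by simp
  obtain Z where Z: "negligible Z"
    and der: "\<And>t. t \<in> {0..?T} - Z \<Longrightarrow> (x has_vector_derivative ?h t) (at t within {0..?T})"
    using ae unfolding eventually_ae_filter_negligible by auto
  have hi: "(?h has_integral x t - x 0) {0..t}" if t: "t \<in> {0..?T}" for t
  proof (rule fundamental_theorem_of_calculus_absolutely_continuous [OF _ _ Z])
    show "absolutely_continuous_on {0..t} x"
      by (rule absolutely_continuous_on_subset [OF AC]) (use t in auto)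
    show "(x has_vector_derivative ?h s) (at s within {0..t})" if "s \<in> {0..t} - Z" for s
      by (rule has_vector_derivative_within_subset [OF der]) (use t that in auto)
  qed (use t in auto)
  \<comment> \<open>Continuity of \<open>x\<close> is read off from that of the indefinite
    integral.\<close>
  have "continuous_on {0..?T} (\<lambda>t. x 0 + integral {0..t} ?h)"
    using hi [of ?T] T by (intro continuous_intros indefinite_integral_continuous_1) auto
  then have cx: "continuous_on {0..?T} x"
  proof (rule continuous_on_eq)
    show "x 0 + integral {0..t} ?h = x t" if "t \<in> {0..?T}" for t
      using integral_unique [OF hi [OF that]] by simp
  qed
  have cont: "continuous_on ({- \<tau>..0} \<union> {0..?T}) x"
  proof (rule continuous_on_closed_Un)
    show "continuous_on {- \<tau>..0} x" using cont_\<phi> by (rule continuous_on_eq) (simp add: init)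
  qed (use cx in auto)
  have "{- \<tau>..0} \<union> {0..?T} = {- \<tau>..?T}" using ivl_disj_un_two_touch(4) [of "- \<tau>" 0 ?T] T \<tau> by simp
  with cont show ?thesis using hi init by (simp add: integral_solution_def)
qed

text \<open>A continuous \<open>x\<close> is bounded on the compact interval, so A3 bounds the
  integrand and \<open>x\<close> is Lipschitz, hence absolutely continuous. The integrand need not
  be continuous in time, so its indefinite integral is differentiated only almost
  everywhere.\<close>

lemma integral_solution_imp_dde_solution:
  assumes x: "integral_solution N x"
  shows "dde_solution f \<phi> \<tau> (real N * \<tau>) x"
  unfolding dde_solution_def
proof (intro conjI)
  let ?T = "real N * \<tau>" and ?h = "\<lambda>s. f s (x s) (x (s - \<tau>))"
  have T: "0 \<le> ?T" using \<tau> by simp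
  show "\<forall>t\<in>{- \<tau>..0}. x t = \<phi> t" using x by (simp add: integral_solution_def)
  have cpt: "compact (x ` {- \<tau>..?T})"
    using x by (intro compact_continuous_image) (auto simp: integral_solution_def)
  obtain B where "B > 0" and "\<forall>y\<in>x ` {- \<tau>..?T}. norm y \<le> B"
    using bounded_pos [THEN iffD1, OF compact_imp_bounded [OF cpt]] by blast
  then have B: "norm (x t) \<le> B" if "t \<in> {- \<tau>..?T}" for t using that by blast
  have hB: "norm (?h s) \<le> K * (1 + B) * (1 + B)" if s: "s \<in> {0..?T}" for s
  proof -
    have "norm (?h s) \<le> K * (1 + norm (x s)) * (1 + norm (x (s - \<tau>)))"
      using s by (rule bound_f)
    also have "\<dots> \<le> K * (1 + B) * (1 + B)"
      using s K \<tau> \<open>B > 0\<close> by (intro mult_mono add_left_mono B) auto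
    finally show ?thesis .
  qed
  have Lip: "norm (x t - x s) \<le> K * (1 + B) * (1 + B) * (t - s)" if "0 \<le> s" "s \<le> t" "t \<le> ?T" for s t
  proof -
    note hi = integral_solution_diff [OF x that]
    have "norm (x t - x s) \<le> integral {s..t} (\<lambda>_. K * (1 + B) * (1 + B))"
      unfolding integral_unique [OF hi, symmetric]
      by (rule Henstock_Kurzweil_Integration.integral_norm_bound_integral)
        (use hi that in \<open>auto intro!: hB\<close>)
    then show ?thesis using that by (simp add: mult_ac)
  qed
  show "absolutely_continuous_on {0..?T} x"
  proof (rule Lipschitz_imp_absolutely_continuous_on)
    fix u v assume "u \<in> {0..?T}" "v \<in> {0..?T}"
    then show "norm (x v - x u) \<le> K * (1 + B) * (1 + B) * \<bar>v - u\<bar>"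
      using Lip[of u v] Lip[of v u] by (cases "u \<le> v") (auto simp: norm_minus_commute)
  qed
  have hi: "(?h has_integral x t - x 0) {0..t}" if "t \<in> {0..?T}" for t
    using x that by (simp add: integral_solution_def)
  define Z where "Z = {t \<in> {0..?T}. \<not> ((\<lambda>u. integral {0..u} ?h) has_vector_derivative ?h t) (at t within {0..?T})}"
  have "negligible Z"
    unfolding Z_def by (rule indefinite_integral_has_vector_derivative_ae) (use hi [of ?T] T in auto)
  moreover have "(x has_vector_derivative ?h t) (at t within {0..?T})" if t: "t \<in> {0..?T}" "t \<notin> Z" for t
  proof (rule has_vector_derivative_transform [where f = "\<lambda>u. x 0 + integral {0..u} ?h"])
    have "((\<lambda>u. integral {0..u} ?h) has_vector_derivative ?h t) (at t within {0..?T})"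
      using t by (simp add: Z_def)
    then show "((\<lambda>u. x 0 + integral {0..u} ?h) has_vector_derivative ?h t) (at t within {0..?T})"
      by (auto intro!: derivative_eq_intros)
    show "x u = x 0 + integral {0..u} ?h" if "u \<in> {0..?T}" for u
      using integral_unique [OF hi [OF that]] by simp
  qed (use t in auto)
  ultimately show "AE t\<in>{0..?T} in lebesgue. (x has_vector_derivative ?h t) (at t within {0..?T})"
    unfolding eventually_ae_filter_negligible by (intro exI [of _ Z]) auto
qed

lemma dde_solution_iff: "dde_solution f \<phi> \<tau> (real N * \<tau>) x \<longleftrightarrow> integral_solution N x"
  using dde_solution_imp_integral_solution integral_solution_imp_dde_solution by blast

end

theorem theorem3p1:
  fixes n :: nat and \<tau> :: real
    and f :: "real \<Rightarrow> real ^ 'd \<Rightarrow> real ^ 'd \<Rightarrow> real ^ 'd"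
    and \<phi> :: "real \<Rightarrow> real ^ 'd"
    and K :: real
  assumes "\<tau> > 0"
    and A1_f: "\<forall>t\<in>{0..(real n + 1) * \<tau>}. continuous_on UNIV (\<lambda>(x, z). f t x z)"
    and A1_phi: "continuous_on {- \<tau>..0} \<phi>"
    and A2: "\<forall>x z. (\<lambda>t. f t x z) \<in> borel_measurable (restrict_space borel {0..(real n + 1) * \<tau>})"
    and "K > 0"
    and A3: "\<forall>t\<in>{0..(real n + 1) * \<tau>}. \<forall>x z. norm (f t x z) \<le> K * (1 + norm x) * (1 + norm z)"
    and A4: "\<exists>L>0. \<forall>t\<in>{0..(real n + 1) * \<tau>}. \<forall>x1 x2 z.
               norm (f t x1 z - f t x2 z) \<le> L * (1 + norm z) * norm (x1 - x2)"
  shows "(\<exists>!x. x \<in> extensional {- \<tau>..(real n + 1) * \<tau>} \<and> dde_solution f \<phi> \<tau> ((real n + 1) * \<tau>) x) \<and>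
         (\<forall>x. dde_solution f \<phi> \<tau> ((real n + 1) * \<tau>) x \<longrightarrow>
            (\<forall>j\<le>n.
               (SUP t\<in>{0..\<tau>}. norm (x (t + real j * \<tau>))) \<le> growth_const K \<tau> \<phi> (Suc j) \<and>
               (\<forall>t\<in>{0..\<tau>}. \<forall>s\<in>{0..\<tau>}.
                  norm (x (t + real j * \<tau>) - x (s + real j * \<tau>))
                    \<le> (1 + growth_const K \<tau> \<phi> j) * (1 + growth_const K \<tau> \<phi> (Suc j)) * K * \<bar>t - s\<bar>)))"
proof -
  obtain L where L: "L > 0" "\<forall>t\<in>{0..(real n + 1) * \<tau>}. \<forall>x1 x2 z.
               norm (f t x1 z - f t x2 z) \<le> L * (1 + norm z) * norm (x1 - x2)"
    using A4 by blast
  have T: "(real n + 1) * \<tau> = real (Suc n) * \<tau>" by simp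
  interpret sublinear_dde f \<phi> \<tau> K L "Suc n"
    by unfold_locales
      (use assms(1,3,5) L(1) A1_f A2 A3 L(2) in \<open>simp_all only: T\<close>)
  show ?thesis
    unfolding T dde_solution_iff
  proof (intro conjI allI impI ballI)
    let ?S = "{- \<tau>..real (Suc n) * \<tau>}"
    obtain x where x: "integral_solution (Suc n) x" using integral_solution_exists by blast
    show "\<exists>!x. x \<in> extensional ?S \<and> integral_solution (Suc n) x"
    proof (intro ex1I conjI)
      \<comment> \<open>Functions are total, so uniqueness on the interval becomes an equality of
        functions only after the values outside are fixed by extensionality.\<close>
      show "restrict x ?S \<in> extensional ?S" by simp
      show "integral_solution (Suc n) (restrict x ?S)"
        by (rule integral_solution_cong [OF _ x]) simp
      fix y assume y: "y \<in> extensional ?S \<and> integral_solution (Suc n) y"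
      show "y = restrict x ?S"
      proof (rule extensionalityI)
        show "y t = restrict x ?S t" if "t \<in> ?S" for t
          using integral_solution_unique [OF _ x, of y t] y that by simp
      qed (use y in auto)
    qed
  next
    fix x j assume x: "integral_solution (Suc n) x" and j: "j \<le> n"
    show "(SUP t\<in>{0..\<tau>}. norm (x (t + real j * \<tau>))) \<le> G (Suc j)"
    proof (rule cSUP_least)
      show "norm (x (t + real j * \<tau>)) \<le> G (Suc j)" if "t \<in> {0..\<tau>}" for t
        using that j by (intro integral_solution_bound [OF x]) (auto simp: algebra_simps)
    qed (use \<open>\<tau> > 0\<close> in auto)
    fix t s assume ts: "t \<in> {0..\<tau>}" "s \<in> {0..\<tau>}"
    have *: "norm (x (t + real j * \<tau>) - x (s + real j * \<tau>)) \<le> (1 + G j) * (1 + G (Suc j)) * K * (t - s)"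
      if "t \<in> {0..\<tau>}" "s \<in> {0..\<tau>}" "s \<le> t" for s t
      using integral_solution_Lipschitz [OF x, of j "s + real j * \<tau>" "t + real j * \<tau>"] that j
      by (simp add: algebra_simps)
    show "norm (x (t + real j * \<tau>) - x (s + real j * \<tau>)) \<le> (1 + G j) * (1 + G (Suc j)) * K * \<bar>t - s\<bar>"
    proof (cases "s \<le> t")
      case True
      then show ?thesis using *[OF ts] by simp
    next
      case False
      then show ?thesis using *[OF ts(2,1)] by (simp add: norm_minus_commute)
    qed
  qed
qed

end
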